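(* Let $T$ be a tree on $n$ vertices and let $\Delta(T)$ denote its maximum degree. Then $$\gamma_g(T) \ge \left\lceil \frac{2n}{\Delta(T)+3} \right\rceil - 1 .$$
   Context: Graphs are finite, simple and nonempty. For a vertex $v$, $N[v]$ is its closed neighborhood; a chosen vertex $v$ dominates all vertices of $N[v]$. The domination game on a graph $G$ is played by two players, Dominator and Staller, who alternately choose vertices of $G$; each chosen vertex must dominate at least one vertex that was not dominated by the previously chosen vertices. The game ends when all vertices of $G$ are dominated. Dominator wants the total number of chosen vertices to be as small as possible, Staller wants it to be as large as possible. The game domination number $\gamma_g(G)$ is the total number of vertices chosen (by both players) when Dominator makes the first move and both players play optimally. *)

theory Defs
  imports Complex_Main "Graph_Theory.Digraph_Component"
begin

text \<open>
  Finite simple graphs are the \<^locale>\<open>graph\<close> locale of the Graph\_Theory entry: finite, symmetric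
  digraphs without loops or parallel arcs, each edge being a pair of opposite arcs.
  Since \<^const>\<open>pre_digraph.cycle\<close> counts an edge traversed back and forth as a (directed) cycle
  of length two, the constants \<^const>\<open>forest\<close> and \<^const>\<open>tree\<close> of the entry are not the
  undirected notions; an undirected cycle is a directed cycle of length at least three.
  Nonemptiness is part of \<^const>\<open>connected\<close>.
\<close>

locale tree_graph = graph +
  assumes connected: "connected G"
    and no_undirected_cycle: "\<not> (\<exists>p. cycle p \<and> 3 \<le> length p)"

text \<open>In a \<^locale>\<open>graph\<close>, the arcs leaving \<open>v\<close> correspond to the edges at \<open>v\<close>.\<close>

definition max_degree :: "('a, 'b) pre_digraph \<Rightarrow> nat" where
  "max_degree G = Max (out_degree G ` verts G)"

definition closed_nbhd :: "('a, 'b) pre_digraph \<Rightarrow> 'a \<Rightarrow> 'a set" where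
  "closed_nbhd G v = {u \<in> verts G. u = v \<or> v \<rightarrow>\<^bsub>G\<^esub> u}"

definition dominated_set :: "('a, 'b) pre_digraph \<Rightarrow> 'a set \<Rightarrow> 'a set" where
  "dominated_set G S = (\<Union>v\<in>S. closed_nbhd G v)"

definition legal_moves :: "('a, 'b) pre_digraph \<Rightarrow> 'a set \<Rightarrow> 'a set" where
  "legal_moves G S = {v \<in> verts G. \<not> closed_nbhd G v \<subseteq> dominated_set G S}"

lemma undominated_decreases:
  assumes "finite (verts G)" "v \<in> legal_moves G S"
  shows "card (verts G - dominated_set G (insert v S)) < card (verts G - dominated_set G S)"
  using assms
  by (intro psubset_card_mono) (auto simp: legal_moves_def dominated_set_def closed_nbhd_def)

text \<open>
  \<open>moves_dominator S\<close> and \<open>moves_staller S\<close> are the numbers of moves still to be made under optimal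
  play when \<open>S\<close> is the set of vertices chosen so far and it is Dominator's, respectively Staller's,
  turn (backward induction). A non-final position always has a legal move (any undominated vertex),
  so \<^const>\<open>Min\<close> and \<^const>\<open>Max\<close> range over finite nonempty sets.
\<close>

function (in graph) moves_dominator :: "'a set \<Rightarrow> nat"
  and moves_staller :: "'a set \<Rightarrow> nat" where
  "moves_dominator S =
     (if verts G \<subseteq> dominated_set G S then 0
      else 1 + Min ((\<lambda>v. moves_staller (insert v S)) ` legal_moves G S))"
| "moves_staller S =
     (if verts G \<subseteq> dominated_set G S then 0
      else 1 + Max ((\<lambda>v. moves_dominator (insert v S)) ` legal_moves G S))"
  by pat_completeness auto

termination (in graph)
  by (relation "measure (\<lambda>x. case x of
        Inl S \<Rightarrow> card (verts G - dominated_set G S) | Inr S \<Rightarrow> card (verts G - dominated_set G S))")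
     (auto intro: undominated_decreases)

declare (in graph) moves_dominator.simps [simp del] moves_staller.simps [simp del]

definition (in graph) game_domination_number :: nat where
  "game_domination_number = moves_dominator {}"

end

theory Submission
  imports Defs
begin

text \<open>
  Whatever has been played, an undominated vertex that ends a longest path among the undominated
  vertices of a tree has at most one undominated neighbour, so Staller can always dominate at most
  two new vertices. As Dominator dominates at most \<open>\<Delta> + 1\<close> new vertices per move, two
  consecutive moves dominate at most \<open>\<Delta> + 3\<close> vertices.
\<close>

context graph
begin

text \<open>Take \<open>u\<close> as the start of a longest path inside \<open>U\<close>. A
  neighbour of \<open>u\<close> in \<open>U\<close> lies on that path, since otherwise it would
  prolong it; and if it came after the second vertex, it would close a cycle of length at least
  three.\<close>

lemma acyclic_induced_leaf:
  assumes "\<not> (\<exists>p. cycle p \<and> 3 \<le> length p)" and "U \<subseteq> verts G" and "U \<noteq> {}"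
  obtains u w where "u \<in> U" and "closed_nbhd G u \<inter> U \<subseteq> {u, w}"
proof -
  define P where "P = (\<lambda>p. \<exists>u v. apath u p v \<and> set (awalk_verts u p) \<subseteq> U)"
  obtain x where x: "x \<in> U" using assms(3) by blast
  have "P []"
    unfolding P_def using x assms(2) by (intro exI[of _ x]) (auto simp: apath_Nil_iff)
  moreover have "length p < Suc (card (verts G))" if Pp: "P p" for p
  proof -
    obtain u v where uv: "apath u p v" using Pp unfolding P_def by blast
    have "length (awalk_verts u p) = card (set (awalk_verts u p))"
      using uv by (simp add: apath_def distinct_card)
    also have "\<dots> \<le> card (verts G)"
      using uv by (intro card_mono) (auto simp: apath_def)
    finally show ?thesis using uv by (simp add: apath_def length_awalk_verts)
  qed
  ultimately obtain p where "P p" and longest: "\<And>q. P q \<Longrightarrow> length q \<le> length p"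
    using ex_has_greatest_nat[of P "[]" length "Suc (card (verts G))"] by auto
  then obtain u v where p: "apath u p v" and pU: "set (awalk_verts u p) \<subseteq> U"
    unfolding P_def by blast
  have uU: "u \<in> U"
    using p pU by (cases p) (auto simp: apath_def)
  \<comment> \<open>\<open>head G (hd p)\<close> is the second vertex of the path. For
    \<open>p = []\<close> it is an arbitrary value, which is harmless because then only
    \<open>w = u\<close> can occur.\<close>
  have "w \<in> {u, head G (hd p)}" if w: "w \<in> closed_nbhd G u \<inter> U" for w
  proof (rule ccontr)
    assume neq: "w \<notin> {u, head G (hd p)}"
    then have "u \<rightarrow>\<^bsub>G\<^esub> w" using w by (auto simp: closed_nbhd_def)
    then have "w \<rightarrow>\<^bsub>G\<^esub> u" using graph_symmetric by blast
    then obtain a where a: "a \<in> arcs G" "tail G a = w" "head G a = u"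
      by (auto simp: arcs_ends_conv)
    have "w \<in> set (awalk_verts u p)"
    proof (rule ccontr)
      assume "w \<notin> set (awalk_verts u p)"
      then have "apath w (a # p) v" "set (awalk_verts w (a # p)) \<subseteq> U"
        using a p pU w by (auto simp: apath_def awalk_Cons_iff)
      then have "P (a # p)" unfolding P_def by blast
      then show False using longest by fastforce
    qed
    then obtain q r where qr: "p = q @ r" "awalk u q w"
      using awalk_decomp[of u p v w] p by (auto simp: apath_def)
    then have "distinct (awalk_verts u q)"
      using p by (auto simp: apath_def awalk_verts_append simp del: awalk_append_iff)
    \<comment> \<open>After its start \<open>w\<close>, the closed walk \<open>a # q\<close> visits
      exactly the vertices of \<open>q\<close>, which are distinct.\<close>
    then have "cycle (a # q)"
      using a qr(2) unfolding cycle_def by (intro exI[of _ w]) (auto simp: awalk_Cons_iff)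
    then have "length q \<le> 1"
      using assms(1) by (metis One_nat_def Suc_le_mono length_Cons not_less_eq_eq numeral_3_eq_3)
    \<comment> \<open>An empty \<open>q\<close> gives \<open>w = u\<close>; a single arc is
      \<open>hd p\<close> and gives \<open>w = head G (hd p)\<close>.\<close>
    then show False
      using neq qr by (cases q) (auto simp: awalk_Cons_iff awalk_Nil_iff)
  qed
  with uU show thesis by (intro that[of u "head G (hd p)"]) auto
qed

lemma finite_closed_nbhd: "finite (closed_nbhd G v)"
  unfolding closed_nbhd_def by (rule finite_subset[OF _ finite_verts]) auto

lemma card_closed_nbhd_le:
  assumes "v \<in> verts G"
  shows "card (closed_nbhd G v) \<le> max_degree G + 1"
proof -
  have "closed_nbhd G v \<subseteq> insert v (head G ` out_arcs G v)"
    by (auto simp: closed_nbhd_def arcs_ends_conv)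
  then have "card (closed_nbhd G v) \<le> card (insert v (head G ` out_arcs G v))"
    by (intro card_mono) auto
  also have "\<dots> \<le> Suc (card (head G ` out_arcs G v))"
    by (rule card_insert_le_m1[THEN order_trans]) auto
  also have "\<dots> \<le> Suc (out_degree G v)"
    unfolding out_degree_def by (simp add: card_image_le[OF finite_out_arcs])
  also have "out_degree G v \<le> max_degree G"
    unfolding max_degree_def using assms by (intro Max_ge) auto
  finally show ?thesis by simp
qed

lemma card_undominated_insert:
  "card (verts G - dominated_set G S)
     \<le> card (verts G - dominated_set G (insert v S)) + card (closed_nbhd G v - dominated_set G S)"
proof -
  have "verts G - dominated_set G S
      \<subseteq> (verts G - dominated_set G (insert v S)) \<union> (closed_nbhd G v - dominated_set G S)"
    by (auto simp: dominated_set_def)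
  then have "card (verts G - dominated_set G S)
      \<le> card ((verts G - dominated_set G (insert v S)) \<union> (closed_nbhd G v - dominated_set G S))"
    by (intro card_mono) (auto simp: finite_closed_nbhd)
  also have "\<dots> \<le> card (verts G - dominated_set G (insert v S))
      + card (closed_nbhd G v - dominated_set G S)"
    by (rule card_Un_le)
  finally show ?thesis .
qed

lemma finite_legal_moves: "finite (legal_moves G S)"
  by (simp add: legal_moves_def)

lemma undominated_legal: "v \<in> verts G - dominated_set G S \<Longrightarrow> v \<in> legal_moves G S"
  by (auto simp: legal_moves_def closed_nbhd_def)

end

context tree_graph
begin

lemma staller_slow_move:
  assumes "\<not> verts G \<subseteq> dominated_set G S"
  obtains v where "v \<in> legal_moves G S" and "card (closed_nbhd G v - dominated_set G S) \<le> 2"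
proof -
  obtain u w where u: "u \<in> verts G - dominated_set G S"
    and uw: "closed_nbhd G u \<inter> (verts G - dominated_set G S) \<subseteq> {u, w}"
    using acyclic_induced_leaf[OF no_undirected_cycle, of "verts G - dominated_set G S"] assms
    by blast
  have "closed_nbhd G u - dominated_set G S \<subseteq> {u, w}"
    using uw by (auto simp: closed_nbhd_def)
  then have "card (closed_nbhd G u - dominated_set G S) \<le> card {u, w}"
    by (intro card_mono) auto
  also have "\<dots> \<le> 2" by (simp add: card_insert_if)
  finally show thesis using that undominated_legal[OF u] by blast
qed

text \<open>The additive terms make the two bounds feed each other. A move of Dominator costs at
  most \<open>2 * (max_degree G + 1)\<close> on the left; with the 4 of the second bound this is
  \<open>2 * (max_degree G + 3)\<close>, paying for the move itself and the extra 1 of the first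
  bound. A slow move of Staller costs at most 4, which is the slack of the second bound.\<close>

lemma undominated_le_moves:
  "2 * card (verts G - dominated_set G S) \<le> (max_degree G + 3) * (moves_dominator S + 1)"
  "2 * card (verts G - dominated_set G S) \<le> (max_degree G + 3) * moves_staller S + 4"
proof (induction S and S rule: moves_dominator_moves_staller.induct)
  case (1 S)
  show ?case
  proof (cases "verts G \<subseteq> dominated_set G S")
    case True
    then show ?thesis by (simp add: Diff_eq_empty_iff[THEN iffD2])
  next
    case False
    define M where "M = (\<lambda>v. moves_staller (insert v S)) ` legal_moves G S"
    have "M \<noteq> {}" using False undominated_legal by (auto simp: M_def)
    then have "Min M \<in> M" by (intro Min_in) (auto simp: M_def finite_legal_moves)
    \<comment> \<open>Here \<open>v\<close> is an optimal move of Dominator, so the move count drops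
      by exactly one.\<close>
    then obtain v where v: "v \<in> legal_moves G S" "Min M = moves_staller (insert v S)"
      unfolding M_def by blast
    have "card (closed_nbhd G v - dominated_set G S) \<le> card (closed_nbhd G v)"
      by (intro card_mono) (auto simp: finite_closed_nbhd)
    also have "\<dots> \<le> max_degree G + 1"
      using v by (intro card_closed_nbhd_le) (simp add: legal_moves_def)
    finally have "2 * card (verts G - dominated_set G S)
        \<le> (max_degree G + 3) * moves_staller (insert v S) + 4 + 2 * (max_degree G + 1)"
      using 1[OF False v(1)] card_undominated_insert[of S v] by (simp add: algebra_simps)
    also have "\<dots> = (max_degree G + 3) * (moves_dominator S + 1)"
      using False v(2) by (simp add: moves_dominator.simps[of S] M_def algebra_simps)
    finally show ?thesis .
  qed
next
  case (2 S)
  show ?case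
  proof (cases "verts G \<subseteq> dominated_set G S")
    case True
    then show ?thesis by (simp add: Diff_eq_empty_iff[THEN iffD2])
  next
    case False
    obtain v where v: "v \<in> legal_moves G S" "card (closed_nbhd G v - dominated_set G S) \<le> 2"
      using staller_slow_move[OF False] .
    have "2 * card (verts G - dominated_set G S)
        \<le> (max_degree G + 3) * (moves_dominator (insert v S) + 1) + 4"
      using 2[OF False v(1)] v(2) card_undominated_insert[of S v] by linarith
    \<comment> \<open>The slow move may be suboptimal for Staller, but the maximum over all legal
      moves is at least its value.\<close>
    also have "moves_dominator (insert v S) + 1 \<le> moves_staller S"
      using False v(1) by (simp add: moves_staller.simps[of S] finite_legal_moves)
    finally show ?thesis by simp
  qed
qed

end

theorem theorem2p2:
  fixes T :: "('a, 'b) pre_digraph"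
  assumes "tree_graph T"
  shows "int (graph.game_domination_number T)
           \<ge> \<lceil>2 * real (card (verts T)) / (real (max_degree T) + 3)\<rceil> - 1"
proof -
  interpret tree_graph T by fact
  have "2 * card (verts T) \<le> (max_degree T + 3) * (game_domination_number + 1)"
    using undominated_le_moves(1)[of "{}"]
    by (simp add: game_domination_number_def dominated_set_def)
  then have "real (2 * card (verts T))
      \<le> real ((max_degree T + 3) * (game_domination_number + 1))"
    by (rule of_nat_mono)
  then have "2 * real (card (verts T)) / (real (max_degree T) + 3)
      \<le> real_of_int (int game_domination_number + 1)"
    by (simp add: divide_le_eq algebra_simps)
  \<comment> \<open>The bound \<open>game_domination_number + 1\<close> is an integer, so it
    survives rounding the quotient up.\<close>
  then show ?thesis using ceiling_le by fastforce
qed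

end
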